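(* Let $K \ge 2$ be an integer and let $\alpha \in [0,1]$. Let $(X,Y,Z),(X_1,Y_1,Z_1),(X_2,Y_2,Z_2),\dots$ be i.i.d., where $X$ takes values in $\mathbb{R}^d$, the true label $Y$ takes values in $[K]=\{1,\dots,K\}$, and the noisy label $Z$ takes values in $[K]$ and is obtained from $Y$ by symmetric label noise with noise probability $\alpha$, i.e. $\mathbb{P}[Z=k\mid Y=k, X]=1-\alpha$ and $\mathbb{P}[Z=l\mid Y=k, X]=\frac{\alpha}{K-1}$ for $l\ne k$. Let $q_k(x)=\mathbb{P}[Z=k\mid X=x]$. For each $n$, let $(q_{1n},\dots,q_{Kn})$ be the output of a deep neural network trained on the noisy data $\tilde{\mathcal{T}}_n=\{(X_1,Z_1),\dots,(X_n,Z_n)\}$ without any label noise mitigation, and suppose this sequence of networks is $L_1$-consistent: $$\lim_{n\to\infty}\mathbb{E}\Big(\sum_{k=1}^K |q_{kn}(X)-q_k(X)|\Big)=0 .$$ Let $\tilde g_n(x)=\arg\max_{k\in[K]} q_{kn}(x)$ be the resulting neural network classifier. If $\alpha<\frac{K-1}{K}$, then $\tilde g_n$ achieves Bayes optimality asymptotically, i.e. $$L(\tilde g_n)\to L(g^* )\quad\text{in probability as } n\to\infty,$$ where $L(\tilde g_n)=\mathbb{P}[\tilde g_n(X)\ne Y\mid \tilde{\mathcal{T}}_n]$ is the error probability with respect to the clean label $Y$ and $L(g^* )$ is the Bayes error for predicting $Y$ from $X$.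
   Context: The pair $(X,Y)$ is a test point independent of the training data. A deep neural network here is a feedforward network (fully connected or convolutional, of any architecture and size, under- or over-parameterized, possibly depending on $n$) computing a function $\mathbb{R}^d\to\mathbb{R}^K$, $x\mapsto (q_{1n}(x),\dots,q_{Kn}(x))$, whose parameters are a (measurable) function of the noisy training data $\tilde{\mathcal{T}}_n$ produced by some training procedure; "without mitigation" means that the noisy labels are used as they are and no correction using $\alpha$ is applied. The expectation in the definition of $L_1$-consistency is over both $X$ and $\tilde{\mathcal{T}}_n$. Ties in the $\arg\max$ are broken by any fixed measurable rule. With $p_k(x)=\mathbb{P}[Y=k\mid X=x]$, the Bayes classifier is $g^*(x)=\arg\max_{k\in[K]}p_k(x)$, and the Bayes error is $L(g^* )=\mathbb{P}[g^*(X)\ne Y]=1-\mathbb{E}[\max_k p_k(X)]$. *)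

theory Defs
  imports "HOL-Probability.Probability"
begin

subsection \<open>Feedforward networks\<close>

text \<open>
  A vector of width m is an element of the space of \<^term>\<open>PiM {..<m} (\<lambda>_. borel :: real measure)\<close>.
  An entry of the weight matrix or of the bias of an affine layer is either a fixed constant or a
  reference to a trainable parameter; several entries may refer to the same parameter.  A fully
  connected layer has a separate parameter for every entry; a convolutional layer has the constant
  0 outside the receptive field of a unit and shares the kernel parameters between units.
  Average pooling and skip connections are affine layers with constant entries.  Activation
  functions may differ from unit to unit, so that a layer can also pass values on unchanged.
\<close>

datatype coefficient = Const real | Param nat

datatype layer =
    Affine nat "nat \<Rightarrow> nat \<Rightarrow> coefficient" "nat \<Rightarrow> coefficient"
  | Activation "nat \<Rightarrow> real \<Rightarrow> real"
  | MaxPool nat "nat \<Rightarrow> nat set"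
  | Softmax

datatype network = Network (nparams: nat) (layers: "layer list")

fun coefficient_value :: "(nat \<Rightarrow> real) \<Rightarrow> coefficient \<Rightarrow> real" where
  "coefficient_value \<theta> (Const c) = c"
| "coefficient_value \<theta> (Param i) = \<theta> i"

fun coefficient_ok :: "nat \<Rightarrow> coefficient \<Rightarrow> bool" where
  "coefficient_ok P (Const c) \<longleftrightarrow> True"
| "coefficient_ok P (Param i) \<longleftrightarrow> i < P"

text \<open>In the following three functions, m is the width of the input of the layer.\<close>

fun out_width :: "nat \<Rightarrow> layer \<Rightarrow> nat" where
  "out_width m (Affine m' W b) = m'"
| "out_width m (Activation \<sigma>) = m"
| "out_width m (MaxPool m' R) = m'"
| "out_width m Softmax = m"

fun layer_ok :: "nat \<Rightarrow> nat \<Rightarrow> layer \<Rightarrow> bool" where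
  "layer_ok P m (Affine m' W b) \<longleftrightarrow>
     (\<forall>i<m'. coefficient_ok P (b i) \<and> (\<forall>j<m. coefficient_ok P (W i j)))"
| "layer_ok P m (Activation \<sigma>) \<longleftrightarrow> (\<forall>i<m. \<sigma> i \<in> borel_measurable borel)"
| "layer_ok P m (MaxPool m' R) \<longleftrightarrow> (\<forall>i<m'. R i \<noteq> {} \<and> R i \<subseteq> {..<m})"
| "layer_ok P m Softmax \<longleftrightarrow> True"

fun apply_layer :: "(nat \<Rightarrow> real) \<Rightarrow> nat \<Rightarrow> layer \<Rightarrow> (nat \<Rightarrow> real) \<Rightarrow> nat \<Rightarrow> real" where
  "apply_layer \<theta> m (Affine m' W b) v =
     (\<lambda>i\<in>{..<m'}. (\<Sum>j<m. coefficient_value \<theta> (W i j) * v j) + coefficient_value \<theta> (b i))"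
| "apply_layer \<theta> m (Activation \<sigma>) v = (\<lambda>i\<in>{..<m}. \<sigma> i (v i))"
| "apply_layer \<theta> m (MaxPool m' R) v = (\<lambda>i\<in>{..<m'}. Max (v ` R i))"
| "apply_layer \<theta> m Softmax v = (\<lambda>i\<in>{..<m}. exp (v i) / (\<Sum>j<m. exp (v j)))"

fun layers_ok :: "nat \<Rightarrow> nat \<Rightarrow> layer list \<Rightarrow> nat \<Rightarrow> bool" where
  "layers_ok P m [] K \<longleftrightarrow> m = K"
| "layers_ok P m (l # ls) K \<longleftrightarrow> layer_ok P m l \<and> layers_ok P (out_width m l) ls K"

fun apply_layers :: "(nat \<Rightarrow> real) \<Rightarrow> nat \<Rightarrow> layer list \<Rightarrow> (nat \<Rightarrow> real) \<Rightarrow> nat \<Rightarrow> real" where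
  "apply_layers \<theta> m [] v = v"
| "apply_layers \<theta> m (l # ls) v = apply_layers \<theta> (out_width m l) ls (apply_layer \<theta> m l v)"

text \<open>
  The coordinates of \<^typ>\<open>real ^ 'd\<close> are enumerated in an arbitrary fixed order.  As the connection
  patterns of layers are arbitrary, the order is immaterial.
\<close>

definition input_vector :: "real ^ 'd \<Rightarrow> nat \<Rightarrow> real" where
  "input_vector x = (\<lambda>j\<in>{..<CARD('d)}. x $ from_nat_into UNIV j)"

definition network_ok :: "'d::finite itself \<Rightarrow> nat \<Rightarrow> network \<Rightarrow> bool" where
  "network_ok _ K N \<longleftrightarrow> layers_ok (nparams N) CARD('d) (layers N) K"

text \<open>The output coordinates \<open>0, \<dots>, K - 1\<close> belong to the labels \<open>1, \<dots>, K\<close>.\<close>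

definition network_output :: "network \<Rightarrow> (nat \<Rightarrow> real) \<Rightarrow> nat \<Rightarrow> real ^ 'd::finite \<Rightarrow> real" where
  "network_output N \<theta> k x = apply_layers \<theta> CARD('d) (layers N) (input_vector x) (k - 1)"

subsection \<open>Classification with noisy labels\<close>

abbreviation labels :: "nat \<Rightarrow> nat measure" where
  "labels K \<equiv> count_space {1..K}"

definition argmax_rule :: "nat \<Rightarrow> ((nat \<Rightarrow> real) \<Rightarrow> nat) \<Rightarrow> bool" where
  "argmax_rule K r \<longleftrightarrow>
     r \<in> measurable (PiM {1..K} (\<lambda>_. borel)) (labels K) \<and>
     (\<forall>v\<in>space (PiM {1..K} (\<lambda>_. borel)). is_arg_max v (\<lambda>k. k \<in> {1..K}) (r v))"

definition argmax_classifier ::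
    "nat \<Rightarrow> ((nat \<Rightarrow> real) \<Rightarrow> nat) \<Rightarrow> (nat \<Rightarrow> 'x \<Rightarrow> real) \<Rightarrow> 'x \<Rightarrow> nat" where
  "argmax_classifier K r f x = r (\<lambda>k\<in>{1..K}. f k x)"

text \<open>The conditional probability of an event A given the random element U with values in S.\<close>

definition cond_prob_given ::
    "'w measure \<Rightarrow> 'u measure \<Rightarrow> ('w \<Rightarrow> 'u) \<Rightarrow> 'w set \<Rightarrow> 'w \<Rightarrow> real" where
  "cond_prob_given M S U A = real_cond_exp M (vimage_algebra (space M) U S) (indicator A)"

text \<open>The function f is a version of \<open>x \<mapsto> P(A | X = x)\<close>.\<close>

definition is_cond_prob_at ::
    "'w measure \<Rightarrow> ('w \<Rightarrow> 'x::topological_space) \<Rightarrow> 'w set \<Rightarrow> ('x \<Rightarrow> real) \<Rightarrow> bool" where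
  "is_cond_prob_at M X A f \<longleftrightarrow>
     f \<in> borel_measurable borel \<and> (AE \<omega> in M. f (X \<omega>) = cond_prob_given M borel X A \<omega>)"

definition symmetric_label_noise ::
    "'w measure \<Rightarrow> nat \<Rightarrow> real \<Rightarrow> ('w \<Rightarrow> 'x::topological_space) \<Rightarrow> ('w \<Rightarrow> nat) \<Rightarrow> ('w \<Rightarrow> nat) \<Rightarrow> bool" where
  "symmetric_label_noise M K \<alpha> X Y Z \<longleftrightarrow>
     (\<forall>l\<in>{1..K}. AE \<omega> in M.
        cond_prob_given M (borel \<Otimes>\<^sub>M labels K) (\<lambda>\<omega>. (X \<omega>, Y \<omega>)) {\<omega> \<in> space M. Z \<omega> = l} \<omega> =
          (if Y \<omega> = l then 1 - \<alpha> else \<alpha> / (real K - 1)))"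

definition error_prob :: "'w measure \<Rightarrow> ('w \<Rightarrow> 'x) \<Rightarrow> ('w \<Rightarrow> nat) \<Rightarrow> ('x \<Rightarrow> nat) \<Rightarrow> real" where
  "error_prob M X Y g = measure M {\<omega> \<in> space M. g (X \<omega>) \<noteq> Y \<omega>}"

text \<open>
  The sample is indexed by the natural numbers: the index 0 belongs to the test point, the indices
  \<open>1, \<dots>, n\<close> to the training data.
\<close>

definition noisy_data ::
    "(nat \<Rightarrow> 'w \<Rightarrow> 'x) \<Rightarrow> (nat \<Rightarrow> 'w \<Rightarrow> nat) \<Rightarrow> nat \<Rightarrow> 'w \<Rightarrow> nat \<Rightarrow> 'x \<times> nat" where
  "noisy_data X Z n \<omega> = (\<lambda>i\<in>{1..n}. (X i \<omega>, Z i \<omega>))"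

abbreviation noisy_data_space :: "nat \<Rightarrow> nat \<Rightarrow> (nat \<Rightarrow> 'x::topological_space \<times> nat) measure" where
  "noisy_data_space K n \<equiv> PiM {1..n} (\<lambda>_. borel \<Otimes>\<^sub>M labels K)"

text \<open>The error probability on the test point, given the noisy data, of a classifier g that depends on the data.\<close>

definition cond_error_prob ::
    "'w measure \<Rightarrow> nat \<Rightarrow> (nat \<Rightarrow> 'w \<Rightarrow> 'x::topological_space) \<Rightarrow> (nat \<Rightarrow> 'w \<Rightarrow> nat) \<Rightarrow> (nat \<Rightarrow> 'w \<Rightarrow> nat) \<Rightarrow>
     nat \<Rightarrow> ((nat \<Rightarrow> 'x \<times> nat) \<Rightarrow> 'x \<Rightarrow> nat) \<Rightarrow> 'w \<Rightarrow> real" where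
  "cond_error_prob M K X Y Z n g =
     cond_prob_given M (noisy_data_space K n) (noisy_data X Z n)
       {\<omega> \<in> space M. g (noisy_data X Z n \<omega>) (X 0 \<omega>) \<noteq> Y 0 \<omega>}"

definition tendsto_in_prob :: "'w measure \<Rightarrow> (nat \<Rightarrow> 'w \<Rightarrow> real) \<Rightarrow> real \<Rightarrow> bool" where
  "tendsto_in_prob M U c \<longleftrightarrow>
     (\<forall>\<epsilon>>0. (\<lambda>n. measure M {\<omega> \<in> space M. \<bar>U n \<omega> - c\<bar> > \<epsilon>}) \<longlonglongrightarrow> 0)"

end

theory Submission
  imports Defs
begin

text \<open>
  Symmetric noise acts affinely on the posteriors: \<open>q\<^sub>k = \<alpha> / (K - 1) + c p\<^sub>k\<close> almost surely, where
  \<open>c = 1 - \<alpha> K / (K - 1)\<close> is positive exactly when \<open>\<alpha> < (K - 1) / K\<close>.  So \<open>p\<close> and \<open>q\<close> have the same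
  maximizers, and the excess error of the plug-in classifier of \<open>f\<close> over the Bayes error lies between
  0 and \<open>1 / c\<close> times the \<open>L\<^sub>1\<close> distance of \<open>f\<close> and \<open>q\<close>.  As the test point is independent of the
  training data, the conditional error probability is the error probability with the data frozen;
  integrating the bound over the data and applying Markov's inequality gives the claim.
\<close>

section \<open>Measurability of network outputs and of their arg max classifiers\<close>

lemma measurable_coefficient_value:
  assumes "coefficient_ok P c" "\<And>i. i < P \<Longrightarrow> (\<lambda>s. \<theta> s i) \<in> borel_measurable S"
  shows "(\<lambda>s. coefficient_value (\<theta> s) c) \<in> borel_measurable S"
  using assms by (cases c) auto

text \<open>Parameters and input both depend on \<open>s\<close>, because measurability is needed
  jointly in the training data, which determine the parameters, and in the test point. Each output
  coordinate is a finite combination of measurable coordinates.\<close>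

lemma measurable_apply_layer:
  assumes "layer_ok P m l" "i < out_width m l"
    and "\<And>i. i < P \<Longrightarrow> (\<lambda>s. \<theta> s i) \<in> borel_measurable S"
    and v: "\<And>j. j < m \<Longrightarrow> (\<lambda>s. v s j) \<in> borel_measurable S"
  shows "(\<lambda>s. apply_layer (\<theta> s) m l (v s) i) \<in> borel_measurable S"
proof (cases l)
  case (Affine m' W b)
  with assms show ?thesis
    by (auto intro!: borel_measurable_add borel_measurable_sum borel_measurable_times
        measurable_coefficient_value[where P = P])
next
  case (Activation \<sigma>)
  with assms show ?thesis
    by (auto intro: measurable_compose[where N = borel])
next
  case (MaxPool m' R)
  with assms have "R i \<subseteq> {..<m}" "i < m'"
    by auto
  then have "(\<lambda>s. Max (v s ` R i)) \<in> borel_measurable S"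
    by (intro borel_measurable_Max) (auto intro: finite_subset v)
  with MaxPool \<open>i < m'\<close> show ?thesis
    by simp
next
  case Softmax
  with assms show ?thesis
    by (auto intro!: borel_measurable_divide borel_measurable_sum borel_measurable_exp)
qed

lemma measurable_apply_layers:
  assumes "layers_ok P m ls K" "k < K"
    and "\<And>i. i < P \<Longrightarrow> (\<lambda>s. \<theta> s i) \<in> borel_measurable S"
    and "\<And>j. j < m \<Longrightarrow> (\<lambda>s. v s j) \<in> borel_measurable S"
  shows "(\<lambda>s. apply_layers (\<theta> s) m ls (v s) k) \<in> borel_measurable S"
  using assms
proof (induction ls arbitrary: m v)
  case (Cons l ls)
  then show ?case
    by (auto intro!: Cons.IH measurable_apply_layer[where P = P])
qed auto

lemma measurable_network_output:
  fixes x :: "'s \<Rightarrow> real ^ 'd::finite"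
  assumes "network_ok TYPE('d) K N" "k \<in> {1..K}"
    and \<theta>: "\<theta> \<in> measurable S (PiM {..<nparams N} (\<lambda>_. borel))"
    and x: "x \<in> borel_measurable S"
  shows "(\<lambda>s. network_output N (\<theta> s) k (x s)) \<in> borel_measurable S"
  unfolding network_output_def
proof (rule measurable_apply_layers)
  show "layers_ok (nparams N) CARD('d) (layers N) K"
    using assms by (simp add: network_ok_def)
  show "k - 1 < K"
    using assms by auto
  show "(\<lambda>s. \<theta> s i) \<in> borel_measurable S" if "i < nparams N" for i
    using measurable_compose[OF \<theta> measurable_component_singleton] that by auto
  have nth: "(\<lambda>y :: real ^ 'd. y $ i) \<in> borel_measurable borel" for i
    by (intro borel_measurable_continuous_onI continuous_intros)
  show "(\<lambda>s. input_vector (x s) j) \<in> borel_measurable S" if "j < CARD('d)" for j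
    using that measurable_compose[OF x nth] by (simp add: input_vector_def)
qed

text \<open>There are finitely many labels, so the set of agreement is a finite union over the
  common value; the claim follows by taking the complement.\<close>

lemma sets_labels_neq:
  assumes f[measurable]: "f \<in> measurable S (labels K)" and g[measurable]: "g \<in> measurable S (labels K)"
  shows "{s \<in> space S. f s \<noteq> g s} \<in> sets S"
proof -
  have "{s \<in> space S. f s \<noteq> g s} = space S - (\<Union>k\<in>{1..K}. {s \<in> space S. f s = k \<and> g s = k})"
    using measurable_space[OF f] by fastforce
  also have "\<dots> \<in> sets S"
    by measurable
  finally show ?thesis .
qed

lemma measurable_argmax_classifier:
  assumes "argmax_rule K r" "\<And>k. k \<in> {1..K} \<Longrightarrow> (\<lambda>s. f s k (x s)) \<in> borel_measurable S"
  shows "(\<lambda>s. argmax_classifier K r (f s) (x s)) \<in> measurable S (labels K)"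
proof -
  have "(\<lambda>s. \<lambda>k\<in>{1..K}. f s k (x s)) \<in> measurable S (PiM {1..K} (\<lambda>_. borel))"
    using assms(2) by (rule measurable_restrict)
  moreover have "r \<in> measurable (PiM {1..K} (\<lambda>_. borel)) (labels K)"
    using assms(1) by (simp add: argmax_rule_def)
  ultimately show ?thesis
    unfolding argmax_classifier_def by (rule measurable_compose)
qed

section \<open>Pointwise regret of arg max rules\<close>

lemma argmax_classifier_props:
  assumes "argmax_rule K r"
  shows "argmax_classifier K r f x \<in> {1..K}"
    and "k \<in> {1..K} \<Longrightarrow> f k x \<le> f (argmax_classifier K r f x) x"
proof -
  let ?v = "\<lambda>k\<in>{1..K}. f k x"
  have "?v \<in> space (PiM {1..K} (\<lambda>_. borel))"
    by (simp add: space_PiM)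
  then have *: "is_arg_max ?v (\<lambda>k. k \<in> {1..K}) (r ?v)"
    using assms by (auto simp: argmax_rule_def)
  then show "argmax_classifier K r f x \<in> {1..K}"
    by (simp add: is_arg_max_linorder argmax_classifier_def)
  show "f k x \<le> f (argmax_classifier K r f x) x" if "k \<in> {1..K}"
    using * that by (auto simp: is_arg_max_linorder argmax_classifier_def)
qed

text \<open>Between the choice \<open>i\<close> made from \<open>p\<close> and the choice
  \<open>j\<close> made from \<open>f\<close>, the shift \<open>a\<close> cancels and
  \<open>c * (p i - p j)\<close> becomes \<open>q i - q j\<close>. Since \<open>f\<close> prefers
  \<open>j\<close>, this gap can only come from the errors of \<open>f\<close> at \<open>i\<close>
  and at \<open>j\<close>.\<close>

lemma argmax_regret_le:
  fixes f p q :: "nat \<Rightarrow> 'x \<Rightarrow> real"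
  assumes r: "argmax_rule K r" and "c > 0"
    and q: "\<And>k. k \<in> {1..K} \<Longrightarrow> q k x = a + c * p k x"
  shows "p (argmax_classifier K r p x) x - p (argmax_classifier K r f x) x
           \<le> 1 / c * (\<Sum>k=1..K. \<bar>f k x - q k x\<bar>)"
proof -
  define i where "i = argmax_classifier K r p x"
  define j where "j = argmax_classifier K r f x"
  have ij: "i \<in> {1..K}" "j \<in> {1..K}" and "f i x \<le> f j x"
    unfolding i_def j_def by (intro argmax_classifier_props[OF r])+
  have "c * (p i x - p j x) = q i x - q j x"
    using ij by (simp add: q algebra_simps)
  also have "\<dots> \<le> (\<Sum>k=1..K. \<bar>f k x - q k x\<bar>)"
  \<comment> \<open>For \<open>i = j\<close> the sum over \<open>{i, j}\<close> would count the
    error once instead of twice, but then the left side is 0.\<close>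
  proof (cases "i = j")
    case False
    have "q i x - q j x \<le> \<bar>f i x - q i x\<bar> + \<bar>f j x - q j x\<bar>"
      using \<open>f i x \<le> f j x\<close> by linarith
    also have "\<dots> = (\<Sum>k\<in>{i, j}. \<bar>f k x - q k x\<bar>)"
      using False by simp
    also have "\<dots> \<le> (\<Sum>k=1..K. \<bar>f k x - q k x\<bar>)"
      using ij by (intro sum_mono2) auto
    finally show ?thesis .
  qed (simp add: sum_nonneg)
  finally show ?thesis
    using \<open>c > 0\<close> by (simp add: i_def j_def field_simps)
qed

section \<open>Independence and conditioning by freezing one variable\<close>

context prob_space
begin

lemma finite_measure_subalgebra_vimage:
  assumes "random_variable S U"
  shows "finite_measure_subalgebra M (vimage_algebra (space M) U S)"
proof
  show "subalgebra M (vimage_algebra (space M) U S)"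
    using sets_image_in_sets[OF refl assms] by (simp add: subalgebra_def)
qed

text \<open>
  The relation \<^const>\<open>indep_var\<close> forces both random variables to have the same type.  Data and test
  point have different types, so their independence is expressed by the product form of the joint
  distribution.
\<close>

lemma indep_var_distr_compose:
  assumes ind: "indep_var S U T V"
    and f[measurable]: "f \<in> measurable S S'" and g[measurable]: "g \<in> measurable T T'"
  shows "distr M (S' \<Otimes>\<^sub>M T') (\<lambda>\<omega>. (f (U \<omega>), g (V \<omega>)))
           = distr M S' (\<lambda>\<omega>. f (U \<omega>)) \<Otimes>\<^sub>M distr M T' (\<lambda>\<omega>. g (V \<omega>))"
proof -
  have [measurable]: "random_variable S U" "random_variable T V"
    and eq: "distr M (S \<Otimes>\<^sub>M T) (\<lambda>\<omega>. (U \<omega>, V \<omega>)) = distr M S U \<Otimes>\<^sub>M distr M T V"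
    using ind by (auto simp: indep_var_distribution_eq)
  \<comment> \<open>\<open>pair_measure_distr\<close> asks for sigma-finiteness of the second image
    measure.\<close>
  interpret gV: prob_space "distr (distr M T V) T' g"
    by (intro prob_space.prob_space_distr prob_space_distr) measurable
  have "distr M S' (\<lambda>\<omega>. f (U \<omega>)) \<Otimes>\<^sub>M distr M T' (\<lambda>\<omega>. g (V \<omega>))
      = distr (distr M S U) S' f \<Otimes>\<^sub>M distr (distr M T V) T' g"
    by (simp add: distr_distr comp_def)
  also have "\<dots> = distr (distr M S U \<Otimes>\<^sub>M distr M T V) (S' \<Otimes>\<^sub>M T') (\<lambda>(x, y). (f x, g y))"
    by (rule pair_measure_distr) (measurable, rule gV.sigma_finite_measure_axioms)
  also have "\<dots> = distr M (S' \<Otimes>\<^sub>M T') (\<lambda>\<omega>. (f (U \<omega>), g (V \<omega>)))"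
    by (simp add: eq[symmetric] distr_distr comp_def)
  finally show ?thesis ..
qed

text \<open>Fubini for the product law, pulled back to \<open>M\<close> in both factors: the inner
  variable \<open>\<omega>'\<close> acts as an independent second draw while \<open>U\<close> stays
  frozen at \<open>\<omega>\<close>.\<close>

lemma nn_integral_indep:
  assumes U[measurable]: "random_variable S U" and V[measurable]: "random_variable T V"
    and eq: "distr M (S \<Otimes>\<^sub>M T) (\<lambda>\<omega>. (U \<omega>, V \<omega>)) = distr M S U \<Otimes>\<^sub>M distr M T V"
    and f: "f \<in> borel_measurable (S \<Otimes>\<^sub>M T)"
  shows "(\<integral>\<^sup>+ \<omega>. f (U \<omega>, V \<omega>) \<partial>M) = (\<integral>\<^sup>+ \<omega>. \<integral>\<^sup>+ \<omega>'. f (U \<omega>, V \<omega>') \<partial>M \<partial>M)"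
proof -
  interpret V: prob_space "distr M T V"
    by (rule prob_space_distr) measurable
  note f[measurable]
  have "(\<integral>\<^sup>+ \<omega>. f (U \<omega>, V \<omega>) \<partial>M) = (\<integral>\<^sup>+ z. f z \<partial>(distr M S U \<Otimes>\<^sub>M distr M T V))"
    by (simp add: eq[symmetric] nn_integral_distr)
  also have "\<dots> = (\<integral>\<^sup>+ u. \<integral>\<^sup>+ v. f (u, v) \<partial>distr M T V \<partial>distr M S U)"
    by (rule V.nn_integral_fst[symmetric]) measurable
  also have "\<dots> = (\<integral>\<^sup>+ \<omega>. \<integral>\<^sup>+ v. f (U \<omega>, v) \<partial>distr M T V \<partial>M)"
    by (rule nn_integral_distr) measurable
  also have "\<dots> = (\<integral>\<^sup>+ \<omega>. \<integral>\<^sup>+ \<omega>'. f (U \<omega>, V \<omega>') \<partial>M \<partial>M)"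
    by (intro nn_integral_cong nn_integral_distr)
      (auto dest: measurable_space[OF U])
  finally show ?thesis .
qed

text \<open>For \<open>u\<close> in the space of \<open>S\<close> this probability is the measure of
  the section of \<open>A\<close> at \<open>u\<close> under the law of \<open>V\<close>, and
  measures of sections depend measurably on the base point.\<close>

lemma measurable_prob_section:
  assumes [measurable]: "random_variable T V" "A \<in> sets (S \<Otimes>\<^sub>M T)"
  shows "(\<lambda>u. prob {\<omega> \<in> space M. (u, V \<omega>) \<in> A}) \<in> borel_measurable S"
proof -
  interpret V: prob_space "distr M T V"
    by (rule prob_space_distr) measurable
  have "(\<lambda>u. measure (distr M T V) (Pair u -` A)) \<in> borel_measurable S"
    unfolding measure_def by (intro borel_measurable_enn2real V.measurable_emeasure_Pair) simp
  moreover have "measure (distr M T V) (Pair u -` A) = prob {\<omega> \<in> space M. (u, V \<omega>) \<in> A}"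
    if "u \<in> space S" for u
    using that by (subst measure_distr) (auto intro!: arg_cong[where f = prob])
  ultimately show ?thesis
    by (simp cong: measurable_cong)
qed

text \<open>The freezing lemma. The right side is a measurable function of \<open>U\<close>, hence
  measurable for the sigma-algebra generated by \<open>U\<close>, and by Fubini it has the same
  integral as the event over every set of that sigma-algebra. These two properties characterize the
  conditional expectation.\<close>

lemma cond_prob_given_indep:
  assumes U[measurable]: "random_variable S U" and V[measurable]: "random_variable T V"
    and eq: "distr M (S \<Otimes>\<^sub>M T) (\<lambda>\<omega>. (U \<omega>, V \<omega>)) = distr M S U \<Otimes>\<^sub>M distr M T V"
    and A[measurable]: "A \<in> sets (S \<Otimes>\<^sub>M T)"
  shows "AE \<omega> in M. cond_prob_given M S U {\<omega> \<in> space M. (U \<omega>, V \<omega>) \<in> A} \<omega>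
           = prob {\<omega>' \<in> space M. (U \<omega>, V \<omega>') \<in> A}"
proof -
  let ?F = "vimage_algebra (space M) U S"
  let ?h = "\<lambda>u. prob {\<omega> \<in> space M. (u, V \<omega>) \<in> A}"
  let ?E = "{\<omega> \<in> space M. (U \<omega>, V \<omega>) \<in> A}"
  interpret F: finite_measure_subalgebra M ?F
    using U by (rule finite_measure_subalgebra_vimage)
  have UF: "U \<in> measurable ?F S"
    by (rule measurable_vimage_algebra1) (use U[THEN measurable_space] in auto)
  note h[measurable] = measurable_prob_section[OF V A]
  have intE: "integrable M (indicator ?E :: 'a \<Rightarrow> real)"
    by (intro integrable_real_indicator) (auto simp: emeasure_eq_measure)
  have inth: "integrable M (\<lambda>\<omega>. ?h (U \<omega>))"
    by (intro integrable_const_bound[where B = 1]) auto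
  show ?thesis
    unfolding cond_prob_given_def
  proof (rule F.real_cond_exp_charact[OF _ intE inth])
    show "(\<lambda>\<omega>. ?h (U \<omega>)) \<in> borel_measurable ?F"
      using UF h by (rule measurable_compose)
    fix B assume "B \<in> sets ?F"
    then obtain C where C[measurable]: "C \<in> sets S" and B: "B = U -` C \<inter> space M"
      using U[THEN measurable_space] by (auto simp: sets_vimage_algebra2)
    \<comment> \<open>Both the conditioning set \<open>B\<close> and the event are functions of the
      pair \<open>(U, V)\<close>, so their intersection is a single integrand to which Fubini
      applies.\<close>
    let ?f = "\<lambda>z. indicator C (fst z) * indicator A z :: ennreal"
    have "(\<integral>\<omega>\<in>B. indicator ?E \<omega> \<partial>M) = enn2real (\<integral>\<^sup>+ \<omega>. ?f (U \<omega>, V \<omega>) \<partial>M)"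
      unfolding set_lebesgue_integral_def
      by (subst integral_eq_nn_integral)
        (auto simp: B indicator_def intro!: arg_cong[where f = enn2real] nn_integral_cong)
    also have "\<dots> = enn2real (\<integral>\<^sup>+ \<omega>. \<integral>\<^sup>+ \<omega>'. ?f (U \<omega>, V \<omega>') \<partial>M \<partial>M)"
      by (subst nn_integral_indep[OF U V eq, where f = ?f]) auto
    also have "\<dots> = enn2real (\<integral>\<^sup>+ \<omega>. ennreal (indicator B \<omega> * ?h (U \<omega>)) \<partial>M)"
    proof (intro arg_cong[where f = enn2real] nn_integral_cong)
      fix \<omega> assume \<omega>: "\<omega> \<in> space M"
      then have [measurable]: "U \<omega> \<in> space S"
        using U[THEN measurable_space] by auto
      have "(\<integral>\<^sup>+ \<omega>'. ?f (U \<omega>, V \<omega>') \<partial>M)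
          = (\<integral>\<^sup>+ \<omega>'. indicator B \<omega> * indicator {\<omega>' \<in> space M. (U \<omega>, V \<omega>') \<in> A} \<omega>' \<partial>M)"
        using \<omega> by (intro nn_integral_cong) (auto simp: B indicator_def)
      also have "\<dots> = indicator B \<omega> * emeasure M {\<omega>' \<in> space M. (U \<omega>, V \<omega>') \<in> A}"
        by (subst nn_integral_cmult_indicator) auto
      finally show "(\<integral>\<^sup>+ \<omega>'. ?f (U \<omega>, V \<omega>') \<partial>M) = ennreal (indicator B \<omega> * ?h (U \<omega>))"
        by (simp add: emeasure_eq_measure indicator_def)
    qed
    also have "\<dots> = (\<integral>\<omega>\<in>B. ?h (U \<omega>) \<partial>M)"
      unfolding set_lebesgue_integral_def B
      by (subst integral_eq_nn_integral) auto
    finally show "(\<integral>\<omega>\<in>B. indicator ?E \<omega> \<partial>M) = (\<integral>\<omega>\<in>B. ?h (U \<omega>) \<partial>M)" .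
  qed
qed

section \<open>Posteriors, label noise and error probabilities\<close>

text \<open>The defining property of conditional expectation, tested on the events
  \<open>X \<in> B\<close> and transferred to the version \<open>f\<close> through almost sure
  equality.\<close>

lemma cond_prob_at_integral:
  assumes X[measurable]: "random_variable borel X" and A[measurable]: "A \<in> events"
    and f: "is_cond_prob_at M X A f" and B[measurable]: "B \<in> sets borel"
  shows "integrable M (\<lambda>\<omega>. indicator B (X \<omega>) * f (X \<omega>))"
    and "(\<integral>\<omega>. indicator B (X \<omega>) * f (X \<omega>) \<partial>M) = prob {\<omega> \<in> A. X \<omega> \<in> B}"
proof -
  let ?F = "vimage_algebra (space M) X borel"
  interpret F: finite_measure_subalgebra M ?F
    using X by (rule finite_measure_subalgebra_vimage)
  have XF: "X \<in> measurable ?F borel"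
    by (rule measurable_vimage_algebra1) auto
  have f_m[measurable]: "f \<in> borel_measurable borel"
    and ae: "AE \<omega> in M. f (X \<omega>) = real_cond_exp M ?F (indicator A) \<omega>"
    using f by (auto simp: is_cond_prob_at_def cond_prob_given_def)
  have BF: "(\<lambda>\<omega>. indicator B (X \<omega>) :: real) \<in> borel_measurable ?F"
    using XF by (rule measurable_compose) simp
  have int: "integrable M (\<lambda>\<omega>. indicator B (X \<omega>) * indicator A \<omega> :: real)"
    by (intro integrable_const_bound[where B = 1]) (auto simp: indicator_def)
  have ae': "AE \<omega> in M. indicator B (X \<omega>) * real_cond_exp M ?F (indicator A) \<omega>
      = indicator B (X \<omega>) * f (X \<omega>)"
    using ae by eventually_elim simp
  note intg = F.real_cond_exp_intg[OF int BF, simplified]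
  show "integrable M (\<lambda>\<omega>. indicator B (X \<omega>) * f (X \<omega>))"
    by (rule integrable_cong_AE_imp[OF intg(1)]) (use ae' in auto)
  have "(\<integral>\<omega>. indicator B (X \<omega>) * f (X \<omega>) \<partial>M)
      = (\<integral>\<omega>. indicator B (X \<omega>) * real_cond_exp M ?F (indicator A) \<omega> \<partial>M)"
    by (rule integral_cong_AE) (use ae' in auto)
  also have "\<dots> = (\<integral>\<omega>. indicator B (X \<omega>) * indicator A \<omega> \<partial>M)"
    by (rule intg(2))
  also have "\<dots> = (\<integral>\<omega>. indicator {\<omega> \<in> A. X \<omega> \<in> B} \<omega> \<partial>M)"
    by (intro Bochner_Integration.integral_cong) (auto simp: indicator_def)
  also have "\<dots> = prob {\<omega> \<in> A. X \<omega> \<in> B}"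
    using sets.sets_into_space[OF A] by (auto intro!: arg_cong[where f = prob])
  finally show "(\<integral>\<omega>. indicator B (X \<omega>) * f (X \<omega>) \<partial>M) = prob {\<omega> \<in> A. X \<omega> \<in> B}" .
qed

text \<open>On the region where \<open>g\<close> predicts \<open>k\<close>, integrating
  \<open>p k\<close> gives the probability of predicting \<open>k\<close> correctly there. Summing
  over \<open>k\<close> gives the probability of a correct prediction.\<close>

lemma error_prob_eq:
  assumes X[measurable]: "random_variable borel X" and Y[measurable]: "random_variable (labels K) Y"
    and p: "\<And>k. k \<in> {1..K} \<Longrightarrow> is_cond_prob_at M X {\<omega> \<in> space M. Y \<omega> = k} (p k)"
    and g[measurable]: "g \<in> measurable borel (labels K)"
  shows "integrable M (\<lambda>\<omega>. p (g (X \<omega>)) (X \<omega>))"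
    and "error_prob M X Y g = 1 - (\<integral>\<omega>. p (g (X \<omega>)) (X \<omega>) \<partial>M)"
proof -
  have Y_in: "Y \<omega> \<in> {1..K}" if "\<omega> \<in> space M" for \<omega>
    using measurable_space[OF Y that] by simp
  have g_in: "g x \<in> {1..K}" for x
    using measurable_space[OF g, of x] by simp
  have Yk[measurable]: "{\<omega> \<in> space M. Y \<omega> = k} \<in> events" for k
    by measurable
  have gk[measurable]: "{x. g x = k} \<in> sets borel" for k
    \<comment> \<open>The intersection also covers \<open>k\<close> outside the label range, where
      the preimage is empty.\<close>
    using measurable_sets[OF g, of "{k} \<inter> {1..K}"] g_in by (auto simp: vimage_def)
  note I = cond_prob_at_integral[OF X Yk p gk]
  \<comment> \<open>The index of \<open>p\<close> is random; the sum of indicators replaces it by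
    fixed indices, for which the integral is known.\<close>
  have eq: "p (g (X \<omega>)) (X \<omega>) = (\<Sum>k=1..K. indicator {x. g x = k} (X \<omega>) * p k (X \<omega>))" for \<omega>
    using g_in[of "X \<omega>"] by (simp add: indicator_def if_distrib sum.delta cong: if_cong)
  show "integrable M (\<lambda>\<omega>. p (g (X \<omega>)) (X \<omega>))"
    unfolding eq by (intro Bochner_Integration.integrable_sum I)
  have "(\<integral>\<omega>. p (g (X \<omega>)) (X \<omega>) \<partial>M)
      = (\<Sum>k=1..K. \<integral>\<omega>. indicator {x. g x = k} (X \<omega>) * p k (X \<omega>) \<partial>M)"
    unfolding eq by (intro Bochner_Integration.integral_sum I)
  also have "\<dots> = (\<Sum>k=1..K. prob {\<omega> \<in> {\<omega> \<in> space M. Y \<omega> = k}. X \<omega> \<in> {x. g x = k}})"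
    by (intro sum.cong refl I)
  also have "\<dots> = prob (\<Union>k\<in>{1..K}. {\<omega> \<in> {\<omega> \<in> space M. Y \<omega> = k}. X \<omega> \<in> {x. g x = k}})"
    by (rule finite_measure_finite_Union[symmetric]) (auto simp: disjoint_family_on_def)
  \<comment> \<open>The double negation presents correct prediction as the complement of the error
    event, the form that \<open>prob_neg\<close> expects.\<close>
  also have "\<dots> = prob {\<omega> \<in> space M. \<not> g (X \<omega>) \<noteq> Y \<omega>}"
    using Y_in by (intro arg_cong[where f = prob]) auto
  also have "\<dots> = 1 - error_prob M X Y g"
    unfolding error_prob_def by (rule prob_neg, rule sets_labels_neq[where K = K]) measurable
  finally show "error_prob M X Y g = 1 - (\<integral>\<omega>. p (g (X \<omega>)) (X \<omega>) \<partial>M)"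
    by simp
qed

text \<open>Tower property: given \<open>X\<close> and \<open>Y\<close>, the noisy label is
  \<open>k\<close> with a probability affine in the indicator of \<open>Y = k\<close>. Conditioning
  further on \<open>X\<close> alone turns this indicator into \<open>p\<close>.\<close>

lemma symmetric_noise_cond_prob:
  assumes X[measurable]: "random_variable borel X" and Y[measurable]: "random_variable (labels K) Y"
    and Z[measurable]: "random_variable (labels K) Z"
    and noise: "symmetric_label_noise M K \<alpha> X Y Z" and k: "k \<in> {1..K}"
    and p: "is_cond_prob_at M X {\<omega> \<in> space M. Y \<omega> = k} p"
    and q: "is_cond_prob_at M X {\<omega> \<in> space M. Z \<omega> = k} q"
  shows "AE \<omega> in M. q (X \<omega>) = \<alpha> / (real K - 1) + (1 - \<alpha> - \<alpha> / (real K - 1)) * p (X \<omega>)"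
proof -
  let ?F = "vimage_algebra (space M) X borel"
  let ?S = "borel \<Otimes>\<^sub>M labels K"
  let ?G = "vimage_algebra (space M) (\<lambda>\<omega>. (X \<omega>, Y \<omega>)) ?S"
  let ?a = "\<alpha> / (real K - 1)" and ?c = "1 - \<alpha> - \<alpha> / (real K - 1)"
  let ?Y = "{\<omega> \<in> space M. Y \<omega> = k}" and ?Z = "{\<omega> \<in> space M. Z \<omega> = k}"
  interpret F: finite_measure_subalgebra M ?F
    using X by (rule finite_measure_subalgebra_vimage)
  interpret G: finite_measure_subalgebra M ?G
    by (rule finite_measure_subalgebra_vimage) measurable
  \<comment> \<open>As a component of the pair, \<open>X\<close> generates a smaller sigma-algebra
    than \<open>(X, Y)\<close>; the tower property needs this nesting.\<close>
  have "X \<in> measurable ?G borel"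
  proof -
    have "(\<lambda>\<omega>. (X \<omega>, Y \<omega>)) \<in> measurable ?G ?S"
      using measurable_space[OF Y] by (intro measurable_vimage_algebra1) (auto simp: space_pair_measure)
    from measurable_compose[OF this measurable_fst] show ?thesis
      by simp
  qed
  from sets_image_in_sets[OF _ this] have sub: "subalgebra ?G ?F"
    by (simp add: subalgebra_def)
  have int: "integrable M (indicator A :: 'a \<Rightarrow> real)" if "A \<in> events" for A
    using that by (intro integrable_real_indicator) (auto simp: emeasure_eq_measure)
  have intY: "integrable M (indicator ?Y :: 'a \<Rightarrow> real)"
    and intZ: "integrable M (indicator ?Z :: 'a \<Rightarrow> real)"
    by (auto intro!: int)
  have "AE \<omega> in M. real_cond_exp M ?G (indicator ?Z) \<omega> = (if Y \<omega> = k then 1 - \<alpha> else ?a)"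
    using noise k by (auto simp: symmetric_label_noise_def cond_prob_given_def)
  \<comment> \<open>\<open>?c\<close> is chosen so that \<open>?a + ?c = 1 - \<alpha>\<close>; the
    case distinction becomes linear in the indicator.\<close>
  then have ae: "AE \<omega> in M. real_cond_exp M ?G (indicator ?Z) \<omega> = ?a + ?c * indicator ?Y \<omega>"
    by (rule AE_mp) (auto intro!: AE_I2)
  have "AE \<omega> in M. real_cond_exp M ?F (real_cond_exp M ?G (indicator ?Z)) \<omega>
      = real_cond_exp M ?F (indicator ?Z) \<omega>"
    by (rule F.real_cond_exp_nested_subalg[OF G.subalg sub intZ])
  moreover have "AE \<omega> in M. real_cond_exp M ?F (real_cond_exp M ?G (indicator ?Z)) \<omega>
      = real_cond_exp M ?F (\<lambda>\<omega>. ?a + ?c * indicator ?Y \<omega>) \<omega>"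
    by (rule F.real_cond_exp_cong[OF ae]) auto
  moreover have "AE \<omega> in M. real_cond_exp M ?F (\<lambda>\<omega>. ?a + ?c * indicator ?Y \<omega>) \<omega>
      = real_cond_exp M ?F (\<lambda>\<omega>. ?a) \<omega> + real_cond_exp M ?F (\<lambda>\<omega>. ?c * indicator ?Y \<omega>) \<omega>"
    by (rule F.real_cond_exp_add) (use intY in auto)
  moreover have "AE \<omega> in M. real_cond_exp M ?F (\<lambda>\<omega>. ?a) \<omega> = ?a"
    by (rule F.real_cond_exp_F_meas) auto
  moreover have "AE \<omega> in M. real_cond_exp M ?F (\<lambda>\<omega>. ?c * indicator ?Y \<omega>) \<omega>
      = ?c * real_cond_exp M ?F (indicator ?Y) \<omega>"
    by (rule F.real_cond_exp_cmult[OF intY])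
  moreover have "AE \<omega> in M. p (X \<omega>) = real_cond_exp M ?F (indicator ?Y) \<omega>"
    "AE \<omega> in M. q (X \<omega>) = real_cond_exp M ?F (indicator ?Z) \<omega>"
    using p q by (auto simp: is_cond_prob_at_def cond_prob_given_def)
  ultimately show ?thesis
    by eventually_elim simp
qed

text \<open>This concerns a fixed score \<open>f\<close>, that is, a network whose training data are
  frozen. The excess error is the mean of the pointwise regret in \<open>p\<close>, which is
  nonnegative because the Bayes rule maximizes \<open>p\<close>, and which is bounded almost surely
  by the error of \<open>f\<close> as an estimate of \<open>q\<close>.\<close>

lemma excess_error_bound:
  assumes X[measurable]: "random_variable borel X" and Y[measurable]: "random_variable (labels K) Y"
    and p: "\<And>k. k \<in> {1..K} \<Longrightarrow> is_cond_prob_at M X {\<omega> \<in> space M. Y \<omega> = k} (p k)"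
    and q: "\<And>k. k \<in> {1..K} \<Longrightarrow> q k \<in> borel_measurable borel"
    and f: "\<And>k. k \<in> {1..K} \<Longrightarrow> f k \<in> borel_measurable borel"
    and r: "argmax_rule K r" and c: "c > 0"
    and qp: "\<And>k. k \<in> {1..K} \<Longrightarrow> AE \<omega> in M. q k (X \<omega>) = a + c * p k (X \<omega>)"
  defines "excess \<equiv> error_prob M X Y (argmax_classifier K r f)
                      - error_prob M X Y (argmax_classifier K r p)"
  shows "0 \<le> excess"
    and "ennreal excess
           \<le> ennreal (1 / c) * (\<integral>\<^sup>+ \<omega>. ennreal (\<Sum>k=1..K. \<bar>f k (X \<omega>) - q k (X \<omega>)\<bar>) \<partial>M)"
proof -
  let ?g = "argmax_classifier K r f" and ?b = "argmax_classifier K r p"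
  let ?d = "\<lambda>\<omega>. p (?b (X \<omega>)) (X \<omega>) - p (?g (X \<omega>)) (X \<omega>)"
  have g: "?g \<in> measurable borel (labels K)"
    using measurable_argmax_classifier[OF r, where f = "\<lambda>_. f" and x = "\<lambda>x. x"] f by simp
  have b: "?b \<in> measurable borel (labels K)"
    using measurable_argmax_classifier[OF r, where f = "\<lambda>_. p" and x = "\<lambda>x. x"] p
    by (simp add: is_cond_prob_at_def)
  note Eg = error_prob_eq[OF X Y p g] and Eb = error_prob_eq[OF X Y p b]
  have int: "integrable M ?d"
    using Eb(1) Eg(1) by (rule Bochner_Integration.integrable_diff)
  have ex: "excess = (\<integral>\<omega>. ?d \<omega> \<partial>M)"
    using Eg Eb by (simp add: excess_def)
  have nonneg: "0 \<le> ?d \<omega>" for \<omega>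
    using argmax_classifier_props(2)[OF r argmax_classifier_props(1)[OF r], of p] by simp
  show "0 \<le> excess"
    unfolding ex by (intro Bochner_Integration.integral_nonneg nonneg)
  \<comment> \<open>Finitely many labels allow one exceptional null set for all \<open>k\<close>, as
    the pointwise bound needs the relation for all labels at once.\<close>
  have "AE \<omega> in M. \<forall>k\<in>{1..K}. q k (X \<omega>) = a + c * p k (X \<omega>)"
    using qp by (intro AE_finite_allI) auto
  then have bound: "AE \<omega> in M. ?d \<omega> \<le> 1 / c * (\<Sum>k=1..K. \<bar>f k (X \<omega>) - q k (X \<omega>)\<bar>)"
    by eventually_elim (rule argmax_regret_le[OF r c], blast)
  have [measurable]: "(\<lambda>\<omega>. \<Sum>k=1..K. \<bar>f k (X \<omega>) - q k (X \<omega>)\<bar>) \<in> borel_measurable M"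
    using f q by (intro borel_measurable_sum borel_measurable_abs borel_measurable_diff)
      (auto intro: measurable_compose[OF X])
  have "ennreal excess = (\<integral>\<^sup>+ \<omega>. ennreal (?d \<omega>) \<partial>M)"
    unfolding ex by (rule nn_integral_eq_integral[symmetric, OF int]) (intro AE_I2 nonneg)
  also have "\<dots> \<le> (\<integral>\<^sup>+ \<omega>. ennreal (1 / c) * ennreal (\<Sum>k=1..K. \<bar>f k (X \<omega>) - q k (X \<omega>)\<bar>) \<partial>M)"
    using bound c by (intro nn_integral_mono_AE)
      (auto elim!: eventually_mono simp: ennreal_mult[symmetric] sum_nonneg intro!: ennreal_leI)
  also have "\<dots> = ennreal (1 / c) * (\<integral>\<^sup>+ \<omega>. ennreal (\<Sum>k=1..K. \<bar>f k (X \<omega>) - q k (X \<omega>)\<bar>) \<partial>M)"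
    by (rule nn_integral_cmult) measurable
  finally show "ennreal excess
      \<le> ennreal (1 / c) * (\<integral>\<^sup>+ \<omega>. ennreal (\<Sum>k=1..K. \<bar>f k (X \<omega>) - q k (X \<omega>)\<bar>) \<partial>M)" .
qed

section \<open>From mean convergence to convergence in probability\<close>

lemma tendsto_in_prob_of_L1:
  assumes [measurable]: "\<And>n. random_variable borel (U n)"
    and lim: "(\<lambda>n. \<integral>\<^sup>+ \<omega>. ennreal \<bar>U n \<omega> - c\<bar> \<partial>M) \<longlonglongrightarrow> 0"
  shows "tendsto_in_prob M U c"
  unfolding tendsto_in_prob_def
proof (intro allI impI)
  fix \<epsilon> :: real assume \<epsilon>: "\<epsilon> > 0"
  let ?I = "\<lambda>n. \<integral>\<^sup>+ \<omega>. ennreal \<bar>U n \<omega> - c\<bar> \<partial>M"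
  have le: "ennreal (prob {\<omega> \<in> space M. \<bar>U n \<omega> - c\<bar> > \<epsilon>}) \<le> ennreal (1 / \<epsilon>) * ?I n" for n
  proof -
    \<comment> \<open>Rescaling by \<open>1 / \<epsilon>\<close> moves the threshold to 1, as in the
      form of Markov's inequality used next.\<close>
    have "ennreal (prob {\<omega> \<in> space M. \<bar>U n \<omega> - c\<bar> > \<epsilon>})
        \<le> emeasure M {\<omega> \<in> space M. 1 \<le> ennreal (1 / \<epsilon>) * ennreal \<bar>U n \<omega> - c\<bar>}"
      unfolding emeasure_eq_measure[symmetric] using \<epsilon>
      by (intro emeasure_mono) (auto simp: ennreal_mult[symmetric] field_simps)
    also have "\<dots> \<le> ennreal (1 / \<epsilon>) * (\<integral>\<^sup>+ \<omega>. ennreal \<bar>U n \<omega> - c\<bar> * indicator (space M) \<omega> \<partial>M)"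
      by (rule nn_integral_Markov_inequality) auto
    also have "\<dots> = ennreal (1 / \<epsilon>) * ?I n"
      by (intro arg_cong2[where f = times] refl nn_integral_cong) auto
    finally show ?thesis .
  qed
  have lim': "(\<lambda>n. ennreal (1 / \<epsilon>) * ?I n) \<longlonglongrightarrow> 0"
    using ennreal_tendsto_cmult[OF _ lim, of "ennreal (1 / \<epsilon>)"] by simp
  have "(\<lambda>n. ennreal (prob {\<omega> \<in> space M. \<bar>U n \<omega> - c\<bar> > \<epsilon>})) \<longlonglongrightarrow> 0"
    by (rule tendsto_sandwich[OF _ _ tendsto_const lim']) (rule eventuallyI, simp, rule eventuallyI, rule le)
  then have "(\<lambda>n. ennreal (prob {\<omega> \<in> space M. \<bar>U n \<omega> - c\<bar> > \<epsilon>})) \<longlonglongrightarrow> ennreal 0"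
    by simp
  then show "(\<lambda>n. prob {\<omega> \<in> space M. \<bar>U n \<omega> - c\<bar> > \<epsilon>}) \<longlonglongrightarrow> 0"
    by (rule tendsto_ennrealD) auto
qed

end

section \<open>Excess error of networks trained on independent noisy data\<close>

theorem corollary1:
  fixes M :: "'w measure"
    and X :: "nat \<Rightarrow> 'w \<Rightarrow> real ^ 'd::finite"
    and Y Z :: "nat \<Rightarrow> 'w \<Rightarrow> nat"
    and K :: nat and \<alpha> :: real
    and p q :: "nat \<Rightarrow> real ^ 'd \<Rightarrow> real"
    and N :: "nat \<Rightarrow> network"
    and train :: "nat \<Rightarrow> (nat \<Rightarrow> (real ^ 'd) \<times> nat) \<Rightarrow> nat \<Rightarrow> real"
    and r :: "(nat \<Rightarrow> real) \<Rightarrow> nat"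
  assumes "prob_space M"
    and "K \<ge> 2" and "\<alpha> \<in> {0..1}"
    and "prob_space.indep_vars M (\<lambda>_. borel \<Otimes>\<^sub>M labels K \<Otimes>\<^sub>M labels K)
           (\<lambda>i \<omega>. (X i \<omega>, Y i \<omega>, Z i \<omega>)) UNIV"
    and "\<And>i. distr M (borel \<Otimes>\<^sub>M labels K \<Otimes>\<^sub>M labels K) (\<lambda>\<omega>. (X i \<omega>, Y i \<omega>, Z i \<omega>)) =
              distr M (borel \<Otimes>\<^sub>M labels K \<Otimes>\<^sub>M labels K) (\<lambda>\<omega>. (X 0 \<omega>, Y 0 \<omega>, Z 0 \<omega>))"
    and "symmetric_label_noise M K \<alpha> (X 0) (Y 0) (Z 0)"
    and "\<And>k. k \<in> {1..K} \<Longrightarrow> is_cond_prob_at M (X 0) {\<omega> \<in> space M. Y 0 \<omega> = k} (p k)"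
    and "\<And>k. k \<in> {1..K} \<Longrightarrow> is_cond_prob_at M (X 0) {\<omega> \<in> space M. Z 0 \<omega> = k} (q k)"
    and "argmax_rule K r"
    and "\<And>n. network_ok TYPE('d) K (N n)"
    and "\<And>n. train n \<in> measurable (noisy_data_space K n) (PiM {..<nparams (N n)} (\<lambda>_. borel))"
    and "(\<lambda>n. \<integral>\<^sup>+ \<omega>. ennreal (\<Sum>k=1..K. \<bar>network_output (N n) (train n (noisy_data X Z n \<omega>)) k (X 0 \<omega>)
                                     - q k (X 0 \<omega>)\<bar>) \<partial>M)
           \<longlonglongrightarrow> 0"
    and "\<alpha> < (real K - 1) / real K"
  shows "tendsto_in_prob M
           (\<lambda>n. cond_error_prob M K X Y Z n
                  (\<lambda>t. argmax_classifier K r (network_output (N n) (train n t))))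
           (error_prob M (X 0) (Y 0) (argmax_classifier K r p))"
proof -
  interpret prob_space M by fact
  note indep = assms(4) and noise = assms(6) and p = assms(7) and q = assms(8) and r = assms(9)
    and net = assms(10) and train = assms(11) and L1 = assms(12)
  let ?T = "borel \<Otimes>\<^sub>M labels K \<Otimes>\<^sub>M labels K :: ((real ^ 'd) \<times> nat \<times> nat) measure"
  define L where "L = error_prob M (X 0) (Y 0) (argmax_classifier K r p)"
  \<comment> \<open>The probability of keeping the true label minus that of any one given wrong
    label.\<close>
  define c where "c = 1 - \<alpha> - \<alpha> / (real K - 1)"
  define G where "G n t = (argmax_classifier K r (network_output (N n) (train n t)) :: real ^ 'd \<Rightarrow> nat)"
    for n and t :: "nat \<Rightarrow> (real ^ 'd) \<times> nat"
  define U where "U n = cond_error_prob M K X Y Z n (G n)" for n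
  define R where "R n t x = (\<Sum>k=1..K. \<bar>network_output (N n) (train n t) k x - q k x\<bar>)" for n and t :: "nat \<Rightarrow> (real ^ 'd) \<times> nat" and x
  have "c > 0"
    using \<open>K \<ge> 2\<close> \<open>\<alpha> < (real K - 1) / real K\<close> by (simp add: c_def field_simps)
  have W: "random_variable ?T (\<lambda>\<omega>. (X i \<omega>, Y i \<omega>, Z i \<omega>))" for i
    using indep by (auto simp: indep_vars_def)
  have X[measurable]: "random_variable borel (X i)" for i
    using measurable_compose[OF W[of i] measurable_fst] by simp
  have Y[measurable]: "random_variable (labels K) (Y i)" for i
    using measurable_compose[OF W[of i] measurable_compose[OF measurable_snd measurable_fst]] by simp
  have Z[measurable]: "random_variable (labels K) (Z i)" for i
    using measurable_compose[OF W[of i] measurable_compose[OF measurable_snd measurable_snd]] by simp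
  have qp: "AE \<omega> in M. q k (X 0 \<omega>) = \<alpha> / (real K - 1) + c * p k (X 0 \<omega>)" if "k \<in> {1..K}" for k
    using symmetric_noise_cond_prob[OF X Y Z noise that p[OF that] q[OF that]] by (simp add: c_def)
  have q_m: "q k \<in> borel_measurable borel" if "k \<in> {1..K}" for k
    using q[OF that] by (simp add: is_cond_prob_at_def)

  \<comment> \<open>For each \<open>n\<close>, the mean distance of the conditional error from the
    Bayes error is at most \<open>1 / c\<close> times the quantity assumed to vanish. Measurability
    of \<open>U n\<close> is recorded for Markov's inequality.\<close>
  have step: "U n \<in> borel_measurable M \<and>
      (\<integral>\<^sup>+ \<omega>. ennreal \<bar>U n \<omega> - L\<bar> \<partial>M)
        \<le> ennreal (1 / c) * (\<integral>\<^sup>+ \<omega>. ennreal (R n (noisy_data X Z n \<omega>) (X 0 \<omega>)) \<partial>M)" for n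
  proof -
    let ?D = "noisy_data X Z n" and ?V = "\<lambda>\<omega>. (X 0 \<omega>, Y 0 \<omega>)"
    let ?S = "noisy_data_space K n :: (nat \<Rightarrow> (real ^ 'd) \<times> nat) measure"
    let ?B = "borel \<Otimes>\<^sub>M labels K :: ((real ^ 'd) \<times> nat) measure"
    \<comment> \<open>The misclassification event as a set of pairs of a data set and a labelled
      test point, as the freezing lemma requires.\<close>
    define A where "A = {z \<in> space (?S \<Otimes>\<^sub>M ?B). G n (fst z) (fst (snd z)) \<noteq> snd (snd z)}"
    note train[measurable]
    \<comment> \<open>General \<open>t\<close> and \<open>x\<close> serve two purposes: projections
      give joint measurability on the product space, and a constant \<open>t\<close> gives the
      network with frozen data.\<close>
    have out: "(\<lambda>s. network_output (N n) (train n (t s)) k (x s)) \<in> borel_measurable Q"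
      if "k \<in> {1..K}" and [measurable]: "t \<in> measurable Q ?S" "x \<in> borel_measurable Q"
      for k and Q :: "'q measure" and t and x :: "'q \<Rightarrow> real ^ 'd"
      using net that(1) by (rule measurable_network_output) measurable
    have D[measurable]: "random_variable ?S ?D"
      unfolding noisy_data_def[abs_def] by measurable
    have V[measurable]: "random_variable ?B ?V"
      by measurable
    \<comment> \<open>The data are a function of the triples with indices \<open>1..n\<close> and
      the labelled test point is a function of the triple with index 0; these index sets are
      disjoint.\<close>
    have indD: "distr M (?S \<Otimes>\<^sub>M ?B) (\<lambda>\<omega>. (?D \<omega>, ?V \<omega>)) = distr M ?S ?D \<Otimes>\<^sub>M distr M ?B ?V"
    proof -
      let ?f = "\<lambda>w. \<lambda>i\<in>{1..n}. (fst (w i), snd (snd (w i)))"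
      let ?g = "\<lambda>w. (fst (w 0), fst (snd (w 0)))"
      let ?W = "\<lambda>I \<omega>. \<lambda>i\<in>I. (X i \<omega>, Y i \<omega>, Z i \<omega>)"
      have "distr M (?S \<Otimes>\<^sub>M ?B) (\<lambda>\<omega>. (?f (?W {1..n} \<omega>), ?g (?W {0} \<omega>)))
          = distr M ?S (\<lambda>\<omega>. ?f (?W {1..n} \<omega>)) \<Otimes>\<^sub>M distr M ?B (\<lambda>\<omega>. ?g (?W {0} \<omega>))"
      proof (rule indep_var_distr_compose[OF indep_var_restrict[OF indep]])
        show "?f \<in> measurable (PiM {1..n} (\<lambda>_. ?T)) ?S"
          by measurable
        show "?g \<in> measurable (PiM {0} (\<lambda>_. ?T)) ?B"
          by measurable
      qed auto
      moreover have "?f (?W {1..n} \<omega>) = ?D \<omega>" for \<omega>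
        by (auto simp: noisy_data_def fun_eq_iff)
      ultimately show ?thesis
        by simp
    qed
    have V_in: "?V \<omega> \<in> space ?B" if "\<omega> \<in> space M" for \<omega>
      using measurable_space[OF Y[of 0] that] by (simp add: space_pair_measure)
    have "(\<lambda>z. G n (fst z) (fst (snd z))) \<in> measurable (?S \<Otimes>\<^sub>M ?B) (labels K)"
      unfolding G_def by (rule measurable_argmax_classifier[OF r], rule out) measurable
    then have A: "A \<in> sets (?S \<Otimes>\<^sub>M ?B)"
      unfolding A_def by (rule sets_labels_neq) measurable
    have in_A: "(t, ?V \<omega>) \<in> A \<longleftrightarrow> G n t (X 0 \<omega>) \<noteq> Y 0 \<omega>" if "t \<in> space ?S" "\<omega> \<in> space M" for t \<omega>
      using that V_in by (auto simp: A_def space_pair_measure)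
    have "AE \<omega> in M. cond_prob_given M ?S ?D {\<omega> \<in> space M. (?D \<omega>, ?V \<omega>) \<in> A} \<omega>
        = prob {\<omega>' \<in> space M. (?D \<omega>, ?V \<omega>') \<in> A}"
      by (rule cond_prob_given_indep[OF D V indD A])
    also have "{\<omega> \<in> space M. (?D \<omega>, ?V \<omega>) \<in> A} = {\<omega> \<in> space M. G n (?D \<omega>) (X 0 \<omega>) \<noteq> Y 0 \<omega>}"
      using in_A measurable_space[OF D] by blast
    finally have "AE \<omega> in M. U n \<omega> = prob {\<omega>' \<in> space M. (?D \<omega>, ?V \<omega>') \<in> A}"
      by (simp add: U_def cond_error_prob_def)
    \<comment> \<open>From here the conditional error is an ordinary error probability of a fixed
      classifier, so the excess bound applies for almost every \<open>\<omega>\<close>.\<close>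
    then have U: "AE \<omega> in M. U n \<omega> = error_prob M (X 0) (Y 0) (G n (?D \<omega>))"
    proof (rule AE_mp, intro AE_I2 impI)
      fix \<omega> assume "\<omega> \<in> space M" and eq: "U n \<omega> = prob {\<omega>' \<in> space M. (?D \<omega>, ?V \<omega>') \<in> A}"
      then have "{\<omega>' \<in> space M. (?D \<omega>, ?V \<omega>') \<in> A} = {\<omega>' \<in> space M. G n (?D \<omega>) (X 0 \<omega>') \<noteq> Y 0 \<omega>'}"
        using in_A measurable_space[OF D] by blast
      then show "U n \<omega> = error_prob M (X 0) (Y 0) (G n (?D \<omega>))"
        by (simp add: eq error_prob_def)
    qed
    have out_t: "network_output (N n) (train n t) k \<in> borel_measurable (borel :: (real ^ 'd) measure)"
      if "k \<in> {1..K}" "t \<in> space ?S" for k t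
      using out[OF that(1), of "\<lambda>_. t" borel "\<lambda>x. x"] that(2) by simp
    \<comment> \<open>The estimation error lifted to pairs of data and labelled test point, so that
      \<open>indD\<close> covers it as well.\<close>
    define R' where "R' z = ennreal (R n (fst z) (fst (snd z)))"
      for z :: "(nat \<Rightarrow> (real ^ 'd) \<times> nat) \<times> (real ^ 'd) \<times> nat"
    let ?h = "\<lambda>z. ennreal (1 / c) * R' z"
    have [measurable]: "R' \<in> borel_measurable (?S \<Otimes>\<^sub>M ?B)"
    proof -
      have "(\<lambda>z. network_output (N n) (train n (fst z)) k (fst (snd z)) - q k (fst (snd z)))
          \<in> borel_measurable (?S \<Otimes>\<^sub>M ?B)" if "k \<in> {1..K}" for k
        using out[OF that, of fst "?S \<Otimes>\<^sub>M ?B" "\<lambda>z. fst (snd z)"]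
          measurable_compose[OF _ q_m[OF that], of "\<lambda>z. fst (snd z)" "?S \<Otimes>\<^sub>M ?B"]
        by (intro borel_measurable_diff) simp_all
      then show ?thesis
        unfolding R'_def[abs_def] R_def
        by (intro measurable_compose[OF _ measurable_ennreal] borel_measurable_sum borel_measurable_abs)
    qed
    have excess: "0 \<le> error_prob M (X 0) (Y 0) (G n t) - L"
      "ennreal (error_prob M (X 0) (Y 0) (G n t) - L)
         \<le> ennreal (1 / c) * (\<integral>\<^sup>+ \<omega>. ennreal (R n t (X 0 \<omega>)) \<partial>M)" if "t \<in> space ?S" for t
      using excess_error_bound[where f = "network_output (N n) (train n t)",
          OF X Y p q_m out_t[OF _ that] r \<open>c > 0\<close> qp]
      unfolding G_def L_def R_def by blast+
    have "(\<integral>\<^sup>+ \<omega>. ennreal \<bar>U n \<omega> - L\<bar> \<partial>M)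
        \<le> (\<integral>\<^sup>+ \<omega>. ennreal (1 / c) * (\<integral>\<^sup>+ \<omega>'. ennreal (R n (?D \<omega>) (X 0 \<omega>')) \<partial>M) \<partial>M)"
    proof (rule nn_integral_mono_AE, use U in \<open>rule AE_mp\<close>, intro AE_I2 impI)
      fix \<omega> assume \<omega>: "\<omega> \<in> space M" and eq: "U n \<omega> = error_prob M (X 0) (Y 0) (G n (?D \<omega>))"
      have "?D \<omega> \<in> space ?S"
        using measurable_space[OF D \<omega>] .
      \<comment> \<open>Nonnegativity of the excess removes the absolute value.\<close>
      from excess[OF this] eq
      show "ennreal \<bar>U n \<omega> - L\<bar> \<le> ennreal (1 / c) * (\<integral>\<^sup>+ \<omega>'. ennreal (R n (?D \<omega>) (X 0 \<omega>')) \<partial>M)"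
        by simp
    qed
    also have "\<dots> = (\<integral>\<^sup>+ \<omega>. \<integral>\<^sup>+ \<omega>'. ?h (?D \<omega>, ?V \<omega>') \<partial>M \<partial>M)"
    proof (rule nn_integral_cong)
      fix \<omega> assume "\<omega> \<in> space M"
      then have [measurable]: "?D \<omega> \<in> space ?S"
        using measurable_space[OF D] by blast
      have "(\<lambda>\<omega>'. R' (?D \<omega>, ?V \<omega>')) \<in> borel_measurable M"
        by measurable
      from nn_integral_cmult[OF this, of "ennreal (1 / c)"]
      show "ennreal (1 / c) * (\<integral>\<^sup>+ \<omega>'. ennreal (R n (?D \<omega>) (X 0 \<omega>')) \<partial>M)
          = (\<integral>\<^sup>+ \<omega>'. ?h (?D \<omega>, ?V \<omega>') \<partial>M)"
        by (simp add: R'_def)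
    qed
    \<comment> \<open>Fubini backwards: by independence the second draw \<open>\<omega>'\<close>
      merges with \<open>\<omega>\<close>, which gives the joint expectation of the consistency
      assumption.\<close>
    also have "\<dots> = (\<integral>\<^sup>+ \<omega>. ?h (?D \<omega>, ?V \<omega>) \<partial>M)"
      by (rule nn_integral_indep[OF D V indD, symmetric]) measurable
    also have "\<dots> = ennreal (1 / c) * (\<integral>\<^sup>+ \<omega>. R' (?D \<omega>, ?V \<omega>) \<partial>M)"
      by (rule nn_integral_cmult) measurable
    also have "\<dots> = ennreal (1 / c) * (\<integral>\<^sup>+ \<omega>. ennreal (R n (?D \<omega>) (X 0 \<omega>)) \<partial>M)"
      by (simp add: R'_def)
    finally have "(\<integral>\<^sup>+ \<omega>. ennreal \<bar>U n \<omega> - L\<bar> \<partial>M)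
        \<le> ennreal (1 / c) * (\<integral>\<^sup>+ \<omega>. ennreal (R n (?D \<omega>) (X 0 \<omega>)) \<partial>M)" .
    moreover have "U n \<in> borel_measurable M"
      unfolding U_def cond_error_prob_def cond_prob_given_def by (rule borel_measurable_cond_exp2)
    ultimately show ?thesis
      by blast
  qed
  have "(\<lambda>n. ennreal (1 / c) * (\<integral>\<^sup>+ \<omega>. ennreal (R n (noisy_data X Z n \<omega>) (X 0 \<omega>)) \<partial>M)) \<longlonglongrightarrow> 0"
    using ennreal_tendsto_cmult[OF _ L1, of "ennreal (1 / c)"] by (simp add: R_def)
  then have "(\<lambda>n. \<integral>\<^sup>+ \<omega>. ennreal \<bar>U n \<omega> - L\<bar> \<partial>M) \<longlonglongrightarrow> 0"
    by (rule tendsto_sandwich[where f = "\<lambda>_. 0", rotated -1]) (use step in auto)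
  then have "tendsto_in_prob M U L"
    by (intro tendsto_in_prob_of_L1) (use step in auto)
  then show ?thesis
    by (simp add: U_def[abs_def] G_def[abs_def] L_def)
qed

end
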